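(* Let $c$ and $m$ be integers with $m>1$, and let $d$ be a positive rational number such that $dm\in\mathbb{N}$ and $c+dm>0$. Let $$a=\frac{c-\sqrt{c^2+4}}{2},\qquad b=\frac{c+\sqrt{c^2+4}}{2}.$$ Then $$\left[0;\overline{c+dm^{n}}\right]_{n=1}^{\infty}=\frac{1}{md+a}\cdot\frac{\displaystyle\sum_{n=0}^{\infty}\frac{(b/d)^n\,m^{-n(n+3)/2}}{(1/m;1/m)_n\,(-a/(dm^2);1/m)_n}}{\displaystyle\sum_{n=0}^{\infty}\frac{(b/d)^n\,m^{-n(n+1)/2}}{(1/m;1/m)_n\,(-a/(dm);1/m)_n}}.$$
   Context: $\mathbb{N}$ denotes the positive integers. $[0;x_1,x_2,x_3,\dots]$ denotes the value (limit of convergents) of the continued fraction $\cfrac{1}{x_1+\cfrac{1}{x_2+\cfrac{1}{x_3+\cdots}}}$, and $[0;\overline{f(n)}]_{n=1}^\infty=[0;f(1),f(2),f(3),\dots]$. Finally $(z;q)_0=1$ and $(z;q)_n=\prod_{k=0}^{n-1}(1-zq^k)$ for $n\ge1$.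
   Formalization: The hypothesis md + a ≠ 0 is added; it excludes only the case c = 0, dm = 1 (where a = −1), in which 1/(md+a) and the terms with n ≥ 1 of the lower series have zero denominators, so the formula is undefined. *)

theory Defs
  imports "HOL-Analysis.Analysis"
begin

(* cf_convergent x N = [0; x 1, ..., x N]: the partial quotients are indexed from 1,
   so x 0 is ignored, and removing x 1 shifts the sequence. *)
fun cf_convergent :: "(nat \<Rightarrow> real) \<Rightarrow> nat \<Rightarrow> real" where
  "cf_convergent x 0 = 0"
| "cf_convergent x (Suc N) = 1 / (x 1 + cf_convergent (\<lambda>n. x (Suc n)) N)"

(* has_cf_value x L states [0; x 1, x 2, ...] = L, including convergence. *)
definition has_cf_value :: "(nat \<Rightarrow> real) \<Rightarrow> real \<Rightarrow> bool" where
  "has_cf_value x L \<longleftrightarrow> cf_convergent x \<longlonglongrightarrow> L"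

definition qpoch :: "real \<Rightarrow> real \<Rightarrow> nat \<Rightarrow> real" where
  "qpoch z q n = (\<Prod>k<n. 1 - z * q ^ k)"

end

theory Submission
  imports Defs
begin

text \<open>With \<open>q = 1/m\<close>, the two series are the values at \<open>n = 0, 1\<close> of
  \<open>T\<^sub>n = qhyp q (-a q\<^sup>n/d) (b q\<^sup>n/d)\<close>. A contiguous relation for \<open>qhyp\<close> shows that
  \<open>y\<^sub>n = T\<^sub>n / (\<Prod>j=1..n. d m\<^sup>j + a)\<close> satisfies \<open>y\<^sub>n = (c + d m\<^bsup>n+1\<^esup>) y\<^bsub>n+1\<^esub> + y\<^bsub>n+2\<^esub>\<close>.
  All \<open>y\<^sub>n\<close> are positive, so the quotients \<open>y\<^bsub>n+1\<^esub> / y\<^sub>n\<close> are tails of the continued fraction,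
  and a contraction argument identifies \<open>y\<^sub>1 / y\<^sub>0\<close> with its value.\<close>

section \<open>Continued fractions with given tails\<close>

lemma cf_convergent_nonneg:
  assumes "\<And>n. 1 \<le> n \<Longrightarrow> 0 \<le> x n"
  shows "0 \<le> cf_convergent x N"
  using assms by (induction x N rule: cf_convergent.induct) auto

text \<open>A single step from \<open>s\<close> to \<open>1 / (x + s)\<close> need not contract: for
  \<open>x = 1\<close> its slope at \<open>s = 0\<close> is -1. Two steps compose to a Moebius map
  of determinant 1 whose denominators \<open>u\<close> and \<open>v\<close> are at least 2, hence
  the factor 1/4.\<close>

lemma two_step_contraction:
  fixes x y s t :: real
  assumes "1 \<le> x" "1 \<le> y" "0 \<le> s" "0 \<le> t"
  shows "\<bar>1 / (x + 1 / (y + s)) - 1 / (x + 1 / (y + t))\<bar> \<le> \<bar>s - t\<bar> / 4"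
proof -
  have eq: "1 / (x + 1 / (y + r)) = (y + r) / (x * (y + r) + 1)" if "0 \<le> r" for r
    using that assms by (simp add: divide_simps)
  have ge: "2 \<le> x * (y + r) + 1" if "0 \<le> r" for r
    using mult_mono[of 1 x 1 "y + r"] that assms by simp
  define u v where "u = x * (y + s) + 1" and "v = x * (y + t) + 1"
  have uv: "2 \<le> u" "2 \<le> v"
    using ge assms by (auto simp: u_def v_def)
  have "1 / (x + 1 / (y + s)) - 1 / (x + 1 / (y + t)) = (y + s) / u - (y + t) / v"
    using eq assms by (simp add: u_def v_def)
  also have "\<dots> = ((y + s) * v - (y + t) * u) / (u * v)"
    using uv by (simp add: diff_frac_eq)
  also have "(y + s) * v - (y + t) * u = s - t"
    by (simp add: u_def v_def algebra_simps)
  finally have "\<bar>1 / (x + 1 / (y + s)) - 1 / (x + 1 / (y + t))\<bar> = \<bar>s - t\<bar> / (u * v)"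
    using uv by (simp add: abs_mult)
  moreover have "4 \<le> u * v"
    using mult_mono[of 2 u 2 v] uv by simp
  ultimately show ?thesis
    by (metis abs_ge_zero divide_left_mono less_le_trans zero_less_mult_iff zero_less_numeral)
qed

text \<open>Each pair of steps gains \<open>1 / 4 = (1 / 2)\<^sup>2\<close>. The constant 2
  accommodates \<open>N = 1\<close>, where one only uses that both numbers lie in [0, 1]. The
  induction passes to \<open>x\<close> and \<open>r\<close> shifted by two, so both are
  generalised.\<close>

lemma cf_convergent_bound:
  assumes "\<And>n. 1 \<le> n \<Longrightarrow> 1 \<le> x n"
    and "\<And>n. 0 \<le> r n"
    and "\<And>n. r n = 1 / (x (Suc n) + r (Suc n))"
  shows "\<bar>cf_convergent x N - r 0\<bar> \<le> 2 * (1 / 2) ^ N"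
  using assms
proof (induction N arbitrary: x r rule: less_induct)
  case (less N)
  have x: "1 \<le> x (Suc n)" for n
    using less.prems(1) by simp
  have r0: "0 \<le> r 0" "r 0 \<le> 1"
    using less.prems(2)[of 0] less.prems(2)[of 1] less.prems(3)[of 0] x[of 0]
    by simp_all
  consider "N = 0" | "N = 1" | k where "N = Suc (Suc k)"
    by (metis One_nat_def not0_implies_Suc)
  then show ?case
  proof cases
    case 1
    then show ?thesis using r0 by simp
  next
    case 2
    have "0 \<le> 1 / x 1" "1 / x 1 \<le> 1"
      using x[of 0] by auto
    then have "\<bar>1 / x 1 - r 0\<bar> \<le> 1"
      using r0 unfolding abs_le_iff by linarith
    then show ?thesis using 2 by simp
  next
    case 3
    let ?x = "\<lambda>n. x (Suc (Suc n))" and ?r = "\<lambda>n. r (Suc (Suc n))"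
    have x2: "1 \<le> ?x n" for n
      by (rule x)
    have IH: "\<bar>cf_convergent ?x k - ?r 0\<bar> \<le> 2 * (1 / 2) ^ k"
    proof (rule less.IH)
      show "k < N" by (simp add: 3)
      show "1 \<le> ?x n" for n by (rule x)
      show "0 \<le> ?r n" for n by (rule less.prems(2))
      show "?r n = 1 / (?x (Suc n) + ?r (Suc n))" for n by (rule less.prems(3))
    qed
    have nn: "0 \<le> cf_convergent ?x k"
      using order_trans[OF zero_le_one x2] by (intro cf_convergent_nonneg)
    have r: "r 0 = 1 / (x 1 + 1 / (x (Suc 1) + ?r 0))"
      using less.prems(3)[of 0] less.prems(3)[of 1] by simp
    have cf: "cf_convergent x N = 1 / (x 1 + 1 / (x (Suc 1) + cf_convergent ?x k))"
      by (simp add: 3)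
    have "\<bar>cf_convergent x N - r 0\<bar> \<le> \<bar>cf_convergent ?x k - ?r 0\<bar> / 4"
      unfolding cf r using x[of 0] x[of 1] nn less.prems(2)
      by (intro two_step_contraction) auto
    also have "\<dots> \<le> 2 * (1 / 2) ^ N"
      using IH by (simp add: 3)
    finally show ?thesis .
  qed
qed

text \<open>The recursion by itself leaves the start \<open>r 0\<close> largely free; nonnegativity
  of all \<open>r n\<close> forces it to be the value of the fraction.\<close>

lemma has_cf_value_if_tails:
  assumes "\<And>n. 1 \<le> n \<Longrightarrow> 1 \<le> x n"
    and "\<And>n. 0 \<le> r n"
    and "\<And>n. r n = 1 / (x (Suc n) + r (Suc n))"
  shows "has_cf_value x (r 0)"
  unfolding has_cf_value_def
proof (rule LIM_zero_cancel, rule Lim_null_comparison)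
  show "\<forall>\<^sub>F N in sequentially. norm (cf_convergent x N - r 0) \<le> 2 * (1 / 2) ^ N"
    using cf_convergent_bound[of x r, OF assms] by simp
  have "(\<lambda>N. 2 * (1 / 2 :: real) ^ N) \<longlonglongrightarrow> 2 * 0"
    by (intro tendsto_mult_left LIMSEQ_power_zero) simp
  then show "(\<lambda>N. 2 * (1 / 2 :: real) ^ N) \<longlonglongrightarrow> 0"
    by simp
qed

section \<open>The basic hypergeometric series\<close>

lemma qpoch_0 [simp]: "qpoch z q 0 = 1"
  by (simp add: qpoch_def)

lemma qpoch_Suc: "qpoch z q (Suc n) = qpoch z q n * (1 - z * q ^ n)"
  by (simp add: qpoch_def)

lemma qpoch_Suc_shift: "qpoch z q (Suc n) = (1 - z) * qpoch (z * q) q n"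
  unfolding qpoch_def by (subst prod.lessThan_Suc_shift) (simp add: mult.assoc)

lemma one_minus_power_pos:
  fixes z q :: real
  assumes "0 < q" "q < 1" "z < 1"
  shows "0 < 1 - z * q ^ k"
proof (cases "z \<le> 0")
  case True
  then have "z * q ^ k \<le> 0"
    using assms by (simp add: mult_nonpos_nonneg)
  then show ?thesis by simp
next
  case False
  then have "z * q ^ k \<le> z * 1"
    using assms by (intro mult_left_mono power_le_one) auto
  then show ?thesis using assms by simp
qed

lemma qpoch_pos:
  assumes "0 < q" "q < 1" "z < 1"
  shows "0 < qpoch z q n"
  unfolding qpoch_def using one_minus_power_pos[OF assms] by (intro prod_pos) auto

text \<open>These are the terms of the basic hypergeometric series 1phi1(0; \<alpha>q; q,
  -\<beta>q). In this normalisation the index shifts needed later multiply both parameters by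
  \<open>q\<close>.\<close>

definition qhyp_term :: "real \<Rightarrow> real \<Rightarrow> real \<Rightarrow> nat \<Rightarrow> real" where
  "qhyp_term q \<alpha> \<beta> k =
    \<beta> ^ k * q ^ (k * (k + 1) div 2) / (qpoch q q k * qpoch (\<alpha> * q) q k)"

definition qhyp :: "real \<Rightarrow> real \<Rightarrow> real \<Rightarrow> real" where
  "qhyp q \<alpha> \<beta> = suminf (qhyp_term q \<alpha> \<beta>)"

lemma triangle_Suc: "Suc k * (Suc k + 1) div 2 = k * (k + 1) div 2 + Suc k"
proof -
  have "Suc k * (Suc k + 1) = k * (k + 1) + 2 * Suc k"
    by simp
  then show ?thesis
    by presburger
qed

lemma qhyp_term_Suc:
  "qhyp_term q \<alpha> \<beta> (Suc k) =
    qhyp_term q \<alpha> \<beta> k * (\<beta> * q ^ Suc k / ((1 - q ^ Suc k) * (1 - \<alpha> * q ^ Suc k)))"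
  unfolding qhyp_term_def triangle_Suc qpoch_Suc by (simp add: power_add mult_ac)

lemma qhyp_term_pos:
  assumes "0 < q" "q < 1" "\<alpha> * q < 1" "0 < \<beta>"
  shows "0 < qhyp_term q \<alpha> \<beta> k"
  unfolding qhyp_term_def using assms
  by (intro divide_pos_pos mult_pos_pos qpoch_pos zero_less_power) auto

text \<open>The ratio \<open>\<rho>\<close> of consecutive terms tends to 0 whatever \<beta> is,
  because of its factor \<open>q ^ Suc k\<close>.\<close>

lemma summable_qhyp_term:
  assumes "0 < q" "q < 1" "\<alpha> * q < 1"
  shows "summable (qhyp_term q \<alpha> \<beta>)"
proof -
  define \<rho> where "\<rho> k = \<beta> * q ^ Suc k / ((1 - q ^ Suc k) * (1 - \<alpha> * q ^ Suc k))" for k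
  have q: "(\<lambda>k. q ^ Suc k) \<longlonglongrightarrow> 0"
    using assms by (intro LIMSEQ_Suc LIMSEQ_power_zero) auto
  have "\<rho> \<longlonglongrightarrow> \<beta> * 0 / ((1 - 0) * (1 - \<alpha> * 0))"
    unfolding \<rho>_def by (intro tendsto_intros q) auto
  then have "(\<lambda>k. norm (\<rho> k)) \<longlonglongrightarrow> 0"
    by (intro tendsto_norm_zero) simp
  then have "\<forall>\<^sub>F k in sequentially. norm (\<rho> k) < 1 / 2"
    by (rule order_tendstoD(2)) simp
  then obtain N where N: "\<And>k. N \<le> k \<Longrightarrow> norm (\<rho> k) < 1 / 2"
    by (auto simp: eventually_sequentially)
  show ?thesis
  proof (rule summable_ratio_test[of "1 / 2" N])
    fix k assume "N \<le> k"
    then have "norm (qhyp_term q \<alpha> \<beta> k) * norm (\<rho> k) \<le> norm (qhyp_term q \<alpha> \<beta> k) * (1 / 2)"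
      using N by (intro mult_left_mono) (auto intro: less_imp_le)
    then show "norm (qhyp_term q \<alpha> \<beta> (Suc k)) \<le> 1 / 2 * norm (qhyp_term q \<alpha> \<beta> k)"
      unfolding qhyp_term_Suc \<rho>_def[symmetric] norm_mult by simp
  qed simp
qed

lemma qhyp_sums:
  assumes "0 < q" "q < 1" "\<alpha> * q < 1"
  shows "qhyp_term q \<alpha> \<beta> sums qhyp q \<alpha> \<beta>"
  unfolding qhyp_def using summable_qhyp_term[OF assms] by (rule summable_sums)

lemma qhyp_pos:
  assumes "0 < q" "q < 1" "\<alpha> * q < 1" "0 < \<beta>"
  shows "0 < qhyp q \<alpha> \<beta>"
  unfolding qhyp_def
  using summable_qhyp_term[OF assms(1-3)] qhyp_term_pos[OF assms] by (rule suminf_pos)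

text \<open>All three series are rewritten as series in the \<open>w k\<close> below. The difference of the two
  sides then becomes the sum of \<open>G k - G (Suc k)\<close> with
  \<open>G k = w k * (1 - q ^ k) * (1 - \<alpha> * q ^ Suc k)\<close>, and \<open>G 0 = 0\<close>.\<close>

lemma qhyp_contiguous:
  fixes q \<alpha> \<beta> :: real
  assumes q: "0 < q" "q < 1" and \<alpha>: "\<alpha> * q < 1"
  shows "(1 - \<alpha> * q) * qhyp q \<alpha> \<beta> =
    (1 + q * (\<beta> - \<alpha>)) * qhyp q (\<alpha> * q) (\<beta> * q) +
    \<alpha> * \<beta> * q ^ 3 / (1 - \<alpha> * q\<^sup>2) * qhyp q (\<alpha> * q\<^sup>2) (\<beta> * q\<^sup>2)"
proof -
  \<comment> \<open>Dividing by \<open>q ^ k\<close> leaves the numerator of the first series over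
    the denominator of the second.\<close>
  define w where "w k = qhyp_term q (\<alpha> * q) (\<beta> * q) k / q ^ k" for k
  define G where "G k = w k * (1 - q ^ k) * (1 - \<alpha> * q ^ Suc k)" for k
  have \<alpha>_less: "\<alpha> * q ^ Suc k < 1" for k
    using one_minus_power_pos[OF q \<alpha>, of k] by (simp add: mult_ac)
  have ne: "1 - \<alpha> * q ^ Suc k \<noteq> 0" "1 - q ^ Suc k \<noteq> 0" for k
    using \<alpha>_less[of k] power_Suc_less_one[OF q] by (auto simp: less_le)
  have pos: "0 < qpoch q q k" "0 < qpoch (\<alpha> * q) q k" "0 < qpoch (\<alpha> * q * q) q k" for k
    using q \<alpha> \<alpha>_less[of 1] by (auto intro!: qpoch_pos simp: mult_ac)
  \<comment> \<open>The left side is \<open>G (Suc k)\<close>; this is what makes the telescoping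
    work.\<close>
  have w_Suc: "w (Suc k) * (1 - q ^ Suc k) * (1 - \<alpha> * q ^ Suc (Suc k)) = w k * \<beta> * q ^ Suc k" for k
  proof -
    have "t * (\<beta> * q * Q / (X * Y)) / Q * X * Y = t / q ^ k * \<beta> * q ^ Suc k"
      if "X \<noteq> 0" "Y \<noteq> 0" "Q \<noteq> 0" for t Q X Y
      using that q by (simp add: field_simps)
    moreover have eq: "\<alpha> * q * q ^ Suc k = \<alpha> * q ^ Suc (Suc k)"
      by (simp add: mult_ac)
    ultimately show ?thesis
      unfolding w_def qhyp_term_Suc eq using q ne(2)[of k] ne(1)[of "Suc k"] by force
  qed
  have t0: "(1 - \<alpha> * q) * qhyp_term q \<alpha> \<beta> k = w k * (1 - \<alpha> * q ^ Suc k)" for k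
  proof -
    \<comment> \<open>Both sides are the product of length \<open>k + 1\<close>, with its last or
      its first factor split off.\<close>
    have "qpoch (\<alpha> * q) q k * (1 - \<alpha> * q ^ Suc k) = (1 - \<alpha> * q) * qpoch (\<alpha> * q * q) q k"
      using qpoch_Suc[of "\<alpha> * q" q k] qpoch_Suc_shift[of "\<alpha> * q" q k] by (simp add: mult.assoc)
    then show ?thesis
      unfolding w_def qhyp_term_def using pos[of k] q
      by (simp add: power_mult_distrib divide_simps) (simp add: mult_ac)
  qed
  have t1: "qhyp_term q (\<alpha> * q) (\<beta> * q) k = w k * q ^ k" for k
    unfolding w_def using q by simp
  \<comment> \<open>The third series matches the \<open>w\<close>-expression one index
    later.\<close>
  have t2: "\<alpha> * \<beta> * q ^ 3 / (1 - \<alpha> * q\<^sup>2) * qhyp_term q (\<alpha> * q\<^sup>2) (\<beta> * q\<^sup>2) k =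
      \<alpha> * q * (w (Suc k) * q ^ Suc k * (1 - q ^ Suc k))" for k
  proof -
    have "qpoch (\<alpha> * q * q) q k * (1 - \<alpha> * q ^ Suc (Suc k)) =
        (1 - \<alpha> * q\<^sup>2) * qpoch (\<alpha> * q\<^sup>2 * q) q k"
      using qpoch_Suc[of "\<alpha> * q * q" q k] qpoch_Suc_shift[of "\<alpha> * q * q" q k]
      by (simp add: mult_ac power2_eq_square)
    then have *: "qpoch (\<alpha> * q\<^sup>2 * q) q k =
        qpoch (\<alpha> * q * q) q k * (1 - \<alpha> * q ^ Suc (Suc k)) / (1 - \<alpha> * q\<^sup>2)"
      using ne(1)[of 1] by (simp add: field_simps power2_eq_square)
    have ws: "w (Suc k) * (1 - q ^ Suc k) = w k * \<beta> * q ^ Suc k / (1 - \<alpha> * q ^ Suc (Suc k))"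
      using w_Suc[of k] ne(1)[of "Suc k"] by (simp add: eq_divide_eq)
    have "\<alpha> * \<beta> * q ^ 3 / (1 - \<alpha> * q\<^sup>2) * qhyp_term q (\<alpha> * q\<^sup>2) (\<beta> * q\<^sup>2) k =
      \<alpha> * q * q ^ Suc k * (w k * \<beta> * q ^ Suc k / (1 - \<alpha> * q ^ Suc (Suc k)))"
      unfolding w_def qhyp_term_def * using q ne(1)[of 1] ne(1)[of "Suc k"] pos[of k]
      by (simp add: power_mult_distrib power2_eq_square power3_eq_cube mult_ac)
    then show ?thesis
      unfolding ws[symmetric] by (simp only: mult_ac)
  qed
  define A where "A = (1 - \<alpha> * q) * qhyp q \<alpha> \<beta>"
  define B where "B = qhyp q (\<alpha> * q) (\<beta> * q)"
  define C where "C = \<alpha> * \<beta> * q ^ 3 / (1 - \<alpha> * q\<^sup>2) * qhyp q (\<alpha> * q\<^sup>2) (\<beta> * q\<^sup>2)"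
  have A: "(\<lambda>k. w k * (1 - \<alpha> * q ^ Suc k)) sums A"
    unfolding A_def t0[symmetric] by (intro sums_mult qhyp_sums q \<alpha>)
  have B: "(\<lambda>k. w k * q ^ k) sums B"
    unfolding B_def t1[symmetric] using \<alpha>_less[of 1] q
    by (intro qhyp_sums) (simp_all add: mult_ac)
  have "(\<lambda>k. \<alpha> * q * (w (Suc k) * q ^ Suc k * (1 - q ^ Suc k))) sums C"
    unfolding C_def t2[symmetric] using \<alpha>_less[of 2] q
    by (intro sums_mult qhyp_sums) (simp_all add: mult_ac eval_nat_numeral)
  \<comment> \<open>The shift by one costs nothing, since the factor \<open>1 - q ^ k\<close>
    vanishes at \<open>k = 0\<close>.\<close>
  then have C: "(\<lambda>k. \<alpha> * q * (w k * q ^ k * (1 - q ^ k))) sums C"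
    by (subst (asm) sums_Suc_iff) simp
  have "(\<lambda>k. \<beta> * q * (w k * q ^ k)) sums (\<beta> * q * B)"
    by (intro sums_mult B)
  moreover have "G (Suc k) = \<beta> * q * (w k * q ^ k)" for k
    unfolding G_def w_Suc by simp
  ultimately have "(\<lambda>k. G (Suc k)) sums (\<beta> * q * B)"
    by simp
  then have G: "G sums (\<beta> * q * B)"
    by (subst (asm) sums_Suc_iff) (simp add: G_def)
  \<comment> \<open>The last bracket sums to 0, but adding it makes the identity with the first
    series hold term by term.\<close>
  have "(\<lambda>k. (1 + q * (\<beta> - \<alpha>)) * (w k * q ^ k) + \<alpha> * q * (w k * q ^ k * (1 - q ^ k))
      + (G k - \<beta> * q * (w k * q ^ k))) sums
      ((1 + q * (\<beta> - \<alpha>)) * B + C + (\<beta> * q * B - \<beta> * q * B))"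
    by (intro sums_add sums_diff sums_mult B C G)
  moreover have "(1 + q * (\<beta> - \<alpha>)) * (w k * q ^ k) + \<alpha> * q * (w k * q ^ k * (1 - q ^ k))
      + (G k - \<beta> * q * (w k * q ^ k)) = w k * (1 - \<alpha> * q ^ Suc k)" for k
    unfolding G_def by (simp add: algebra_simps)
  ultimately have "A = (1 + q * (\<beta> - \<alpha>)) * B + C"
    using sums_unique2[OF A] by simp
  then show ?thesis
    unfolding A_def B_def C_def .
qed

section \<open>The continued fraction\<close>

lemma powr_triangle:
  fixes M :: real
  assumes "1 < M"
  shows "M powr (- (real n * (real n + 1) / 2)) = (1 / M) ^ (n * (n + 1) div 2)"
proof -
  have "real n * (real n + 1) / 2 = real (n * (n + 1) div 2)"
    by (subst real_of_nat_div) (auto simp: algebra_simps)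
  then show ?thesis
    using assms by (simp only: powr_minus powr_realpow) (simp add: power_one_over inverse_eq_divide)
qed

text \<open>The additional factor \<open>(1 / M) ^ n\<close> will be absorbed into \<beta>, so that
  the numerator is the same kind of series as the denominator.\<close>

lemma powr_triangle_shifted:
  fixes M :: real
  assumes "1 < M"
  shows "M powr (- (real n * (real n + 3) / 2)) = (1 / M) ^ n * (1 / M) ^ (n * (n + 1) div 2)"
proof -
  have "- (real n * (real n + 3) / 2) = - real n + - (real n * (real n + 1) / 2)"
    by (simp add: field_simps)
  then have "M powr (- (real n * (real n + 3) / 2)) =
      M powr (- real n) * M powr (- (real n * (real n + 1) / 2))"
    by (simp only: powr_add)
  also have "M powr (- real n) = (1 / M) ^ n"
    using assms by (simp add: powr_minus powr_realpow power_one_over inverse_eq_divide)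
  finally show ?thesis
    using powr_triangle[OF assms] by simp
qed

text \<open>Convergence of both series is part of the claim, through \<open>sums\<close>. The
  condition \<open>nonzero_denominator\<close> excludes exactly the case \<open>c = 0\<close>,
  \<open>d * m = 1\<close>: there \<open>a = -1\<close>, and the stated formula divides by
  zero.\<close>

theorem corollary1:
  fixes c m :: int and d a b :: real
  assumes "m > 1"
    and "d \<in> \<rat>" and "d > 0"
    and "d * m \<in> \<nat>"
    and "c + d * m > 0"
    and a: "a = (c - sqrt (c\<^sup>2 + 4)) / 2"
    and b: "b = (c + sqrt (c\<^sup>2 + 4)) / 2"
    and nonzero_denominator: "m * d + a \<noteq> 0"
  shows "\<exists>S T.
    (\<lambda>n. (b / d) ^ n * m powr (- (real n * (real n + 3) / 2)) /
          (qpoch (1 / m) (1 / m) n * qpoch (- a / (d * m\<^sup>2)) (1 / m) n)) sums S \<and>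
    (\<lambda>n. (b / d) ^ n * m powr (- (real n * (real n + 1) / 2)) /
          (qpoch (1 / m) (1 / m) n * qpoch (- a / (d * m)) (1 / m) n)) sums T \<and>
    has_cf_value (\<lambda>n. c + d * m ^ n) (1 / (m * d + a) * (S / T))"
proof -
  define M where "M = real_of_int m"
  define q where "q = 1 / M"
  have M: "1 < M"
    using \<open>m > 1\<close> by (simp add: M_def)
  have q: "0 < q" "q < 1"
    using M by (auto simp: q_def)
  have "\<bar>real_of_int c\<bar> = sqrt ((real_of_int c)\<^sup>2)"
    by simp
  also have "\<dots> < sqrt ((real_of_int c)\<^sup>2 + 4)"
    by (rule real_sqrt_less_mono) simp
  finally have "0 < b"
    unfolding b by simp
  \<comment> \<open>That is, \<open>a\<close> and \<open>b\<close> are the roots of x^2 - c x -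
    1.\<close>
  have ab: "a * b = - 1" "a + b = c"
    unfolding a b by (simp_all add: field_simps flip: power2_eq_square)
  \<comment> \<open>Integrality of \<open>d * m\<close> sharpens \<open>c + d * m > 0\<close> to a
    lower bound 1, as the contraction argument requires.\<close>
  obtain k where k: "d * M = real k"
    using \<open>d * m \<in> \<nat>\<close> by (auto simp: M_def Nats_def)
  have "0 < real k"
    using k M \<open>d > 0\<close> by (metis less_trans mult_pos_pos zero_less_one)
  then have "1 \<le> real k"
    by simp
  have "0 < c + int k"
    using \<open>c + d * m > 0\<close> k unfolding M_def by linarith
  then have "1 \<le> real_of_int (c + int k)"
    by simp
  then have ck: "1 \<le> c + real k"
    by simp
  \<comment> \<open>The sign of \<open>real k + a\<close> is read off from this product, whose other
    factor is positive; the value 0 is then ruled out by hypothesis.\<close>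
  have "(real k + a) * (real k + b) = real k * (c + real k) - 1"
    using ab by (simp add: algebra_simps flip: ab(2))
  moreover have "1 \<le> real k * (c + real k)"
    using mult_mono[of 1 "real k" 1 "c + real k"] ck \<open>1 \<le> real k\<close> by simp
  ultimately have "0 \<le> (real k + a) * (real k + b)"
    by simp
  then have "0 \<le> real k + a"
    using \<open>0 < b\<close> \<open>0 < real k\<close> by (simp add: zero_le_mult_iff)
  then have base_pos: "0 < d * M + a"
    using nonzero_denominator k by (simp add: M_def mult.commute)
  have mono: "d * M \<le> d * M ^ Suc n" for n
    using M \<open>d > 0\<close> by simp
  have den_pos: "0 < d * M ^ Suc n + a" for n
    using mono[of n] base_pos by linarith
  define \<alpha> \<beta> where "\<alpha> n = - a / d * q ^ n" and "\<beta> n = b / d * q ^ n" for n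
  \<comment> \<open>This is \<open>den_pos\<close> in disguise: \<open>1 - \<alpha> n * q\<close> is
    \<open>d * M ^ Suc n + a\<close> divided by \<open>d * M ^ Suc n\<close>.\<close>
  have \<alpha>_less: "\<alpha> n * q < 1" for n
    using den_pos[of n] M \<open>d > 0\<close> by (simp add: \<alpha>_def q_def field_simps)
  have \<beta>_pos: "0 < \<beta> n" for n
    using \<open>0 < b\<close> \<open>0 < d\<close> q by (simp add: \<beta>_def)
  define T where "T n = qhyp q (\<alpha> n) (\<beta> n)" for n
  have T_pos: "0 < T n" for n
    unfolding T_def using q \<alpha>_less \<beta>_pos by (intro qhyp_pos)
  \<comment> \<open>This is \<open>qhyp_contiguous\<close> multiplied by
    \<open>u = d * M ^ Suc n\<close>. The relation \<open>a + b = c\<close> produces the partial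
    quotient, and \<open>a * b = - 1\<close> gives the last term numerator 1.\<close>
  have T_rec: "(d * M ^ Suc n + a) * T n = (c + d * M ^ Suc n) * T (Suc n)
      + T (Suc (Suc n)) / (d * M ^ Suc (Suc n) + a)" for n
  proof -
    define u where "u = d * M ^ Suc n"
    have u: "0 < u" "0 < u + a" "0 < u * M + a"
      using den_pos[of n] den_pos[of "Suc n"] M \<open>d > 0\<close> by (simp_all add: u_def mult_ac)
    have \<alpha>: "\<alpha> n = - a * M / u" "\<alpha> n * q = - a / u" "\<alpha> n * q\<^sup>2 = - a / (u * M)"
      and \<beta>: "\<beta> n = b * M / u"
      using M \<open>d > 0\<close> by (simp_all add: \<alpha>_def \<beta>_def u_def q_def field_simps power2_eq_square)
    have e1: "1 - \<alpha> n * q = (u + a) / u"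
      unfolding \<alpha>(2) using u by (simp add: field_simps)
    have e2: "1 + q * (\<beta> n - \<alpha> n) = (c + u) / u"
      unfolding \<alpha>(1) \<beta> q_def ab(2)[symmetric] using u M by (simp add: field_simps)
    have "1 - \<alpha> n * q\<^sup>2 = (u * M + a) / (u * M)"
      unfolding \<alpha>(3) using u M by (simp add: field_simps)
    moreover have "\<alpha> n * \<beta> n * q ^ 3 = - (a * b) * (1 / (u\<^sup>2 * M))"
      unfolding \<alpha>(1) \<beta> q_def using u M
      by (simp add: field_simps power2_eq_square power3_eq_cube)
    ultimately have e3: "\<alpha> n * \<beta> n * q ^ 3 / (1 - \<alpha> n * q\<^sup>2) = 1 / (u * (u * M + a))"
      unfolding ab using u M by (simp add: power2_eq_square)
    have shift: "\<alpha> (Suc n) = \<alpha> n * q" "\<beta> (Suc n) = \<beta> n * q"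
      "\<alpha> (Suc (Suc n)) = \<alpha> n * q\<^sup>2" "\<beta> (Suc (Suc n)) = \<beta> n * q\<^sup>2"
      by (simp_all add: \<alpha>_def \<beta>_def power2_eq_square)
    have "(u + a) / u * T n = (c + u) / u * T (Suc n) + 1 / (u * (u * M + a)) * T (Suc (Suc n))"
      using qhyp_contiguous[OF q \<alpha>_less[of n], of "\<beta> n"]
      unfolding e1 e2 e3 T_def shift .
    moreover have "x * T n = y * T (Suc n) + T (Suc (Suc n)) / z"
      if "x / u * T n = y / u * T (Suc n) + 1 / (u * z) * T (Suc (Suc n))" "z \<noteq> 0" for x y z
      using that u by (simp add: field_simps)
    ultimately have "(u + a) * T n = (c + u) * T (Suc n) + T (Suc (Suc n)) / (u * M + a)"
      using u by simp
    then show ?thesis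
      by (simp add: u_def mult_ac)
  qed
  \<comment> \<open>In the notation of the overview this is the quotient of y_(n+1) by y_n.\<close>
  define r where "r n = T (Suc n) / T n / (d * M ^ Suc n + a)" for n
  have "has_cf_value (\<lambda>n. c + d * M ^ n) (r 0)"
  proof (rule has_cf_value_if_tails)
    fix n :: nat
    show "1 \<le> c + d * M ^ n" if "1 \<le> n"
      using mono[of "n - 1"] that k ck by simp
    show "0 \<le> r n"
      unfolding r_def using T_pos den_pos by (simp add: less_imp_le)
    have "T (Suc n) * r (Suc n) = T (Suc (Suc n)) / (d * M ^ Suc (Suc n) + a)"
      unfolding r_def using T_pos[of "Suc n"] by simp
    then have "T (Suc n) * (c + d * M ^ Suc n + r (Suc n)) = T n * (d * M ^ Suc n + a)"
      using T_rec[of n] by (simp only: distrib_left mult.commute)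
    moreover have "0 < T n * (d * M ^ Suc n + a)"
      using T_pos den_pos by (rule mult_pos_pos)
    ultimately have "r n * (c + d * M ^ Suc n + r (Suc n)) = 1"
      unfolding r_def[of n] by (simp add: zero_less_mult_iff less_le del: power_Suc)
    then show "r n = 1 / (c + d * M ^ Suc n + r (Suc n))"
      by (metis eq_divide_eq mult_zero_right zero_neq_one)
  qed
  then have cf: "has_cf_value (\<lambda>n. c + d * m ^ n) (1 / (m * d + a) * (T 1 / T 0))"
    by (simp add: r_def M_def mult.commute)
  \<comment> \<open>The extra power of 1/m from the exponent n(n+3)/2 turns \<open>b / d\<close>
    into \<open>\<beta> 1\<close>, and \<open>\<alpha> 1 * q\<close> is
    \<open>- a / (d * m\<^sup>2)\<close>.\<close>
  have S: "(\<lambda>n. (b / d) ^ n * m powr (- (real n * (real n + 3) / 2)) /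
      (qpoch (1 / m) (1 / m) n * qpoch (- a / (d * m\<^sup>2)) (1 / m) n)) = qhyp_term q (\<alpha> 1) (\<beta> 1)"
    using powr_triangle_shifted[OF M] M
    by (intro ext) (simp add: qhyp_term_def \<alpha>_def \<beta>_def q_def M_def power_mult_distrib
        power2_eq_square power_divide mult_ac)
  have T: "(\<lambda>n. (b / d) ^ n * m powr (- (real n * (real n + 1) / 2)) /
      (qpoch (1 / m) (1 / m) n * qpoch (- a / (d * m)) (1 / m) n)) = qhyp_term q (\<alpha> 0) (\<beta> 0)"
    using powr_triangle[OF M] M
    by (intro ext) (simp add: qhyp_term_def \<alpha>_def \<beta>_def q_def M_def)
  have "qhyp_term q (\<alpha> n) (\<beta> n) sums T n" for n
    unfolding T_def using q \<alpha>_less by (rule qhyp_sums)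
  then show ?thesis
    unfolding S T using cf by blast
qed

end
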